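(* Let $p^{*}$ be the critical threshold for the north-east oriented percolation on $\mathbb{Z}^2$. Then for any $p \in [0,1]$ with $p < p^{*}$, Breaker almost surely has a winning strategy for the $(1,1)$ Maker-Breaker percolation game on $p$-polluted $\mathbb{Z}^2$.
   Context: $\mathbb{Z}^2$ denotes the square lattice graph (vertices $(x,y)$ with $x,y\in\mathbb{Z}$, edges between points at $\ell_1$-distance $1$). Bond percolation: each edge of $\mathbb{Z}^2$ is declared open with probability $p$, independently of all other edges, and closed otherwise; $(\mathbb{Z}^2)_p$ is the random subgraph with all vertices of $\mathbb{Z}^2$ and exactly the open edges. The $(1,1)$ Maker-Breaker percolation game on $p$-polluted $\mathbb{Z}^2$: first bond percolation with parameter $p$ is performed to obtain the board $(\mathbb{Z}^2)_p$. After all the randomness is realised, Maker chooses a vertex $v_0$. Then the game is played on the open edges: in each round, first Maker claims one as yet unclaimed open edge and then Breaker claims one as yet unclaimed open edge. Breaker wins if at some finite point of the game the connected component of $v_0$ in the graph formed by Maker's edges and the unclaimed open edges is finite (in particular he wins immediately if the open cluster, i.e. connected component in $(\mathbb{Z}^2)_p$, of $v_0$ is finite); otherwise Maker wins. "Almost surely" refers to the choice of the random board: with probability $1$, the board is such that Breaker has a winning strategy whichever $v_0$ Maker chooses. North-east oriented percolation on $\mathbb{Z}^2$: orient each edge of $\mathbb{Z}^2$ in the direction of increasing coordinate (horizontal edges to the east, vertical edges to the north), and declare each oriented edge open with probability $p$ independently; denote the resulting measure by $\mathbb{P}_p^{\rightarrow}$. The critical threshold is $$p^{*} = \inf\{p\in[0,1]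 : \mathbb{P}_p^{\rightarrow}((0,0)\text{ is on an infinite open oriented path})>0\}.$$ *)

theory Defs
  imports "HOL-Probability.Probability"
begin

type_synonym vertex = "int \<times> int"
type_synonym edge = "vertex set"

definition Z2_edges :: "edge set" where
  "Z2_edges = {{u, v} | u v. \<bar>fst u - fst v\<bar> + \<bar>snd u - snd v\<bar> = 1}"

text \<open>
  Bernoulli bond percolation on an arbitrary set \<open>A\<close> of (oriented or unoriented) edges:
  a configuration \<open>\<omega>\<close> declares the edge \<open>e \<in> A\<close> open iff \<open>\<omega> e\<close> holds.
\<close>

definition bond_percolation :: "'e set \<Rightarrow> real \<Rightarrow> ('e \<Rightarrow> bool) measure" where
  "bond_percolation A p = PiM A (\<lambda>_. measure_pmf (bernoulli_pmf p))"

definition open_edges :: "'e set \<Rightarrow> ('e \<Rightarrow> bool) \<Rightarrow> 'e set" where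
  "open_edges A \<omega> = {e \<in> A. \<omega> e}"


subsection \<open>North-east oriented percolation\<close>

definition NE_edges :: "(vertex \<times> vertex) set" where
  "NE_edges = {((x, y), (x + 1, y)) | x y. True} \<union> {((x, y), (x, y + 1)) | x y. True}"

definition on_infinite_oriented_path :: "(vertex \<times> vertex) set \<Rightarrow> vertex \<Rightarrow> bool" where
  "on_infinite_oriented_path F v \<longleftrightarrow>
     (\<exists>\<gamma> :: nat \<Rightarrow> vertex. (\<forall>n. (\<gamma> n, \<gamma> (Suc n)) \<in> F) \<and> v \<in> range \<gamma>)"

definition oriented_critical_threshold :: real where
  "oriented_critical_threshold =
     Inf {p \<in> {0..1}.
       measure (bond_percolation NE_edges p)
         {\<omega> \<in> space (bond_percolation NE_edges p).
            on_infinite_oriented_path (open_edges NE_edges \<omega>) (0, 0)} > 0}"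


subsection \<open>The (1,1) Maker-Breaker percolation game\<close>

definition component :: "edge set \<Rightarrow> vertex \<Rightarrow> vertex set" where
  "component F v = {w. (v, w) \<in> {(a, b). {a, b} \<in> F}\<^sup>*}"

text \<open>
  A history is the list of all edges claimed so far, in chronological order. Maker moves first
  and the players alternate, so Maker claimed the entries with even index (counting from \<open>0\<close>)
  and Breaker those with odd index.
\<close>

definition maker_edges :: "edge list \<Rightarrow> edge set" where
  "maker_edges h = {h ! i | i. i < length h \<and> even i}"

definition unclaimed_edges :: "edge set \<Rightarrow> edge list \<Rightarrow> edge set" where
  "unclaimed_edges E h = E - set h"

text \<open>
  A strategy of either player prescribes the next edge to claim, given the history. Its values at
  histories where the other player is to move are never used. The nonemptiness condition
  only matters on finite boards, where Breaker has won before the first move anyway.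
\<close>

type_synonym strategy = "edge list \<Rightarrow> edge"

definition legal_strategy :: "edge set \<Rightarrow> strategy \<Rightarrow> bool" where
  "legal_strategy E s \<longleftrightarrow>
     (\<forall>h. unclaimed_edges E h \<noteq> {} \<longrightarrow> s h \<in> unclaimed_edges E h)"

text \<open>The history after \<open>k\<close> moves when Maker plays \<open>\<tau>\<close> and Breaker plays \<open>\<sigma>\<close>.\<close>

primrec play :: "strategy \<Rightarrow> strategy \<Rightarrow> nat \<Rightarrow> edge list" where
  "play \<tau> \<sigma> 0 = []"
| "play \<tau> \<sigma> (Suc k) =
     play \<tau> \<sigma> k @ [if even k then \<tau> (play \<tau> \<sigma> k) else \<sigma> (play \<tau> \<sigma> k)]"

definition breaker_won :: "edge set \<Rightarrow> vertex \<Rightarrow> edge list \<Rightarrow> bool" where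
  "breaker_won E v\<^sub>0 h \<longleftrightarrow> finite (component (maker_edges h \<union> unclaimed_edges E h) v\<^sub>0)"

definition breaker_winning_strategy :: "edge set \<Rightarrow> vertex \<Rightarrow> strategy \<Rightarrow> bool" where
  "breaker_winning_strategy E v\<^sub>0 \<sigma> \<longleftrightarrow>
     legal_strategy E \<sigma> \<and>
     (\<forall>\<tau>. legal_strategy E \<tau> \<longrightarrow> (\<exists>k. breaker_won E v\<^sub>0 (play \<tau> \<sigma> k)))"

text \<open>
  Maker picks \<open>v\<^sub>0\<close> after seeing the board \<open>E\<close>, and Breaker's strategy may depend on both.
\<close>

definition breaker_wins_game :: "edge set \<Rightarrow> bool" where
  "breaker_wins_game E \<longleftrightarrow> (\<forall>v\<^sub>0. \<exists>\<sigma>. breaker_winning_strategy E v\<^sub>0 \<sigma>)"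

end

theory Submission
  imports Defs
begin

text \<open>
  Breaker pairs, at every vertex, the edge leaving to the east with the edge leaving to the north,
  and answers a claim on one of them by claiming the other. Maker then owns at most one of the two
  edges leaving each vertex to the north-east. Orient all edges to the north or east. In a graph of
  out-degree at most one in which the forward path from \<open>v\<^sub>0\<close> ends, at \<open>t\<close> say, every vertex of the
  component of \<open>v\<^sub>0\<close> has a forward path to the same \<open>t\<close>: a step forward from such a vertex has to
  follow that path, and a step backward only prolongs it. Hence the component lies in the backward
  oriented cluster of \<open>t\<close> on the board, while \<open>t\<close> itself lies in the forward oriented cluster of
  \<open>v\<^sub>0\<close> (\<open>component_subset_backward_cluster\<close>).

  If all forward and backward oriented clusters of the board are finite, there are only finitely
  many candidates for \<open>t\<close>, so the union \<open>R\<close> of their backward clusters is a finite set known before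
  the game starts. Only the pairs at vertices of \<open>R\<close> matter, and Breaker uses every move that the
  pairing leaves free to claim another edge from these pairs. So after finitely many rounds all of
  them are claimed, and the component of \<open>v\<^sub>0\<close> is confined to \<open>R\<close>
  (\<open>pairing_strategy\<close>, \<open>breaker_wins_if_oriented_clusters_finite\<close>).

  Below the oriented threshold the origin almost surely starts no infinite oriented path, and so by
  Koenig's lemma its oriented cluster is finite. The forward cluster of an arbitrary vertex of the
  unoriented board is a translate of this cluster, and the backward cluster a point reflection of
  it; the countably many exceptional null sets are harmless (\<open>AE_finite_clusters\<close>).
\<close>

section \<open>Oriented clusters\<close>

lemma NE_edges_iff: "(v, w) \<in> NE_edges \<longleftrightarrow> w = v + (1, 0) \<or> w = v + (0, 1)"
  by (cases v; cases w) (auto simp: NE_edges_def)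

lemma Z2_edges_cases:
  assumes "{v, w} \<in> Z2_edges"
  obtains "(v, w) \<in> NE_edges" | "(w, v) \<in> NE_edges"
proof -
  obtain a b c d where v: "v = (a, b)" and w: "w = (c, d)"
    by (cases v; cases w)
  have "\<bar>a - c\<bar> + \<bar>b - d\<bar> = 1"
    using assms by (auto simp: Z2_edges_def doubleton_eq_iff v w)
  then consider "c = a + 1 \<and> d = b" | "a = c + 1 \<and> d = b" | "c = a \<and> d = b + 1" | "c = a \<and> b = d + 1"
    by linarith
  then show thesis
    by cases (use that in \<open>auto simp: NE_edges_iff v w\<close>)
qed

lemma NE_edge_in_Z2_edges: "(v, w) \<in> NE_edges \<Longrightarrow> {v, w} \<in> Z2_edges"
  unfolding Z2_edges_def mem_Collect_eq
  by (intro exI[of _ v] exI[of _ w]) (auto simp: NE_edges_iff)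

text \<open>
  For north-east edges, unlike the existence of an infinite path, this is decided by finitely many
  edges, which is what makes it usable both for Koenig's lemma and for measurability.
\<close>

primrec oriented_path_of_length :: "(vertex \<times> vertex) set \<Rightarrow> nat \<Rightarrow> vertex \<Rightarrow> bool" where
  "oriented_path_of_length F 0 v = True"
| "oriented_path_of_length F (Suc n) v = (\<exists>w. (v, w) \<in> F \<and> oriented_path_of_length F n w)"

lemma oriented_path_of_length_SucD:
  "oriented_path_of_length F (Suc n) v \<Longrightarrow> oriented_path_of_length F n v"
proof (induction n arbitrary: v)
  case (Suc n)
  then obtain w where "(v, w) \<in> F" "oriented_path_of_length F (Suc n) w"
    by (metis oriented_path_of_length.simps(2))
  with Suc.IH[of w] show ?case
    unfolding oriented_path_of_length.simps(2) by blast
qed simp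

lemma oriented_path_of_length_mono:
  assumes "m \<le> n" "oriented_path_of_length F n v"
  shows "oriented_path_of_length F m v"
  using assms by (induction n rule: dec_induct) (auto dest: oriented_path_of_length_SucD simp del: oriented_path_of_length.simps)

text \<open>
  The step of Koenig's lemma. If each of the at most two successors only had paths of bounded
  length, then so would \<open>v\<close>.
\<close>

lemma long_paths_extend:
  assumes "F \<subseteq> NE_edges" and long: "\<And>n. oriented_path_of_length F n v"
  shows "\<exists>w. (v, w) \<in> F \<and> (\<forall>n. oriented_path_of_length F n w)"
proof (rule ccontr)
  assume "\<not> ?thesis"
  then have "\<forall>w. \<exists>n. (v, w) \<in> F \<longrightarrow> \<not> oriented_path_of_length F n w"
    by blast
  then obtain N where N: "\<And>w. (v, w) \<in> F \<Longrightarrow> \<not> oriented_path_of_length F (N w) w"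
    by metis
  define n where "n = max (N (v + (1, 0))) (N (v + (0, 1)))"
  obtain w where w: "(v, w) \<in> F" "oriented_path_of_length F n w"
    using long[of "Suc n"] by auto
  then have "w = v + (1, 0) \<or> w = v + (0, 1)"
    using assms(1) by (auto simp only: NE_edges_iff[symmetric])
  then have "N w \<le> n"
    unfolding n_def by (elim disjE) simp_all
  then show False
    using N[OF w(1)] w(2) oriented_path_of_length_mono by blast
qed

lemma on_infinite_oriented_path_iff_long_paths:
  assumes "F \<subseteq> NE_edges"
  shows "on_infinite_oriented_path F v \<longleftrightarrow> (\<forall>n. oriented_path_of_length F n v)"
proof
  assume "on_infinite_oriented_path F v"
  then obtain \<gamma> i where \<gamma>: "\<And>n. (\<gamma> n, \<gamma> (Suc n)) \<in> F" "v = \<gamma> i"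
    by (auto simp: on_infinite_oriented_path_def)
  have "oriented_path_of_length F n (\<gamma> i)" for n i
  proof (induction n arbitrary: i)
    case (Suc n)
    then show ?case
      unfolding oriented_path_of_length.simps(2) using \<gamma>(1) by blast
  qed simp
  then show "\<forall>n. oriented_path_of_length F n v"
    by (simp add: \<gamma>(2))
next
  assume long: "\<forall>n. oriented_path_of_length F n v"
  have "\<exists>\<gamma>. \<forall>i. ((\<forall>n. oriented_path_of_length F n (\<gamma> i)) \<and> (i = 0 \<longrightarrow> \<gamma> i = v)) \<and>
      (\<gamma> i, \<gamma> (Suc i)) \<in> F"
  proof (rule dependent_nat_choice)
    fix w and i :: nat
    assume "(\<forall>n. oriented_path_of_length F n w) \<and> (i = 0 \<longrightarrow> w = v)"
    then show "\<exists>w'. ((\<forall>n. oriented_path_of_length F n w') \<and> (Suc i = 0 \<longrightarrow> w' = v)) \<and> (w, w') \<in> F"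
      using long_paths_extend[OF assms, of w] by blast
  qed (use long in blast)
  then obtain \<gamma> where "\<gamma> 0 = v" "\<And>n. (\<gamma> n, \<gamma> (Suc n)) \<in> F"
    by blast
  then show "on_infinite_oriented_path F v"
    unfolding on_infinite_oriented_path_def by (metis rangeI)
qed

lemma finite_oriented_cluster:
  assumes F: "F \<subseteq> NE_edges" and "\<not> on_infinite_oriented_path F v"
  shows "finite (F\<^sup>* `` {v})"
proof -
  have "\<not> oriented_path_of_length F n v \<Longrightarrow> finite (F\<^sup>* `` {v})" for n
  proof (induction n arbitrary: v)
    case (Suc n)
    have "F\<^sup>* `` {v} = {v} \<union> (\<Union>w\<in>F `` {v}. F\<^sup>* `` {w})"
      by (auto elim: converse_rtranclE intro: converse_rtrancl_into_rtrancl)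
    moreover have "F `` {v} \<subseteq> {v + (1, 0), v + (0, 1)}"
      using F by (auto simp: NE_edges_iff)
    then have "finite (F `` {v})"
      by (rule finite_subset) simp
    ultimately show ?case
      using Suc by auto
  qed simp
  then show ?thesis
    using assms on_infinite_oriented_path_iff_long_paths by blast
qed

section \<open>Pairing strategies\<close>

lemma maker_edges_subset: "maker_edges h \<subseteq> set h"
  by (auto simp: maker_edges_def)

lemma maker_edges_round:
  assumes "even (length h)"
  shows "maker_edges (h @ [a, b]) = insert a (maker_edges h)"
proof -
  have "maker_edges (h @ [a, b]) = (\<lambda>i. (h @ [a, b]) ! i) ` {i. i < length h + 2 \<and> even i}"
    by (auto simp: maker_edges_def)
  also have "{i. i < length h + 2 \<and> even i} = insert (length h) {i. i < length h \<and> even i}"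
    using assms by (auto simp: less_Suc_eq)
  also have "(\<lambda>i. (h @ [a, b]) ! i) ` \<dots> = insert a (maker_edges h)"
    by (auto simp: maker_edges_def nth_append image_iff)
  finally show ?thesis .
qed

text \<open>
  A pairing strategy only prevents Maker from owning both edges of a pair; to win in finite time,
  Breaker must also force every edge of \<open>F\<close> to be claimed eventually, since Maker may play
  elsewhere forever. This is why a free move is spent inside \<open>F\<close>: as long as \<open>F\<close> has unclaimed
  edges, each round then uses up at least one of them. Extra edges never hurt Breaker, because an
  answer is due only if the partner of Maker's edge is still unclaimed.
\<close>

lemma pairing_strategy:
  fixes \<pi> :: "edge \<Rightarrow> edge"
  assumes "infinite E" "finite F" "F \<subseteq> E" and involution: "\<And>e. \<pi> (\<pi> e) = e"
  obtains \<sigma> where "legal_strategy E \<sigma>"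
    and "\<forall>\<tau>. legal_strategy E \<tau> \<longrightarrow> (\<exists>k. set (play \<tau> \<sigma> k) \<subseteq> E \<and> F \<subseteq> set (play \<tau> \<sigma> k) \<and>
           (\<forall>e\<in>F. \<pi> e \<in> F \<longrightarrow> \<pi> e \<noteq> e \<longrightarrow> e \<in> maker_edges (play \<tau> \<sigma> k) \<longrightarrow>
              \<pi> e \<notin> maker_edges (play \<tau> \<sigma> k)))"
proof -
  define \<sigma> where "\<sigma> h =
    (if \<pi> (last h) \<in> F - set h then \<pi> (last h)
     else if F - set h \<noteq> {} then SOME e. e \<in> F - set h
     else SOME e. e \<in> E - set h)" for h
  have reply_in_F: "\<sigma> h \<in> F - set h" if "F - set h \<noteq> {}" for h
    using some_in_eq[of "F - set h"] that by (auto simp: \<sigma>_def)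
  have unclaimed: "E - set h \<noteq> {}" for h
    using Diff_infinite_finite[OF List.finite_set \<open>infinite E\<close>, of h] by (rule infinite_imp_nonempty)
  have legal: "\<sigma> h \<in> E - set h" for h
  proof (cases "F - set h = {}")
    case True
    then show ?thesis
      using some_in_eq[of "E - set h"] unclaimed[of h] by (auto simp: \<sigma>_def)
  next
    case False
    then show ?thesis
      using reply_in_F \<open>F \<subseteq> E\<close> by blast
  qed
  show thesis
  proof
    show "legal_strategy E \<sigma>"
      using legal by (simp add: legal_strategy_def unclaimed_edges_def)
  next
    show "\<forall>\<tau>. legal_strategy E \<tau> \<longrightarrow> (\<exists>k. set (play \<tau> \<sigma> k) \<subseteq> E \<and> F \<subseteq> set (play \<tau> \<sigma> k) \<and>
           (\<forall>e\<in>F. \<pi> e \<in> F \<longrightarrow> \<pi> e \<noteq> e \<longrightarrow> e \<in> maker_edges (play \<tau> \<sigma> k) \<longrightarrow>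
              \<pi> e \<notin> maker_edges (play \<tau> \<sigma> k)))"
    proof (intro allI impI)
      fix \<tau>
      assume "legal_strategy E \<tau>"
      then have legal_\<tau>: "\<tau> h \<in> E - set h" for h
        using unclaimed by (simp add: legal_strategy_def unclaimed_edges_def)
      let ?h = "\<lambda>m. play \<tau> \<sigma> (2 * m)"
      \<comment> \<open>The partner of an edge owned by Maker has to be claimed already, not merely missed by Maker
        so far; otherwise Maker could still take it in the next round.\<close>
      have invariant: "length (?h m) = 2 * m \<and> set (?h m) \<subseteq> E \<and> card (F - set (?h m)) \<le> card F - m \<and>
          (\<forall>e\<in>F. \<pi> e \<in> F \<longrightarrow> \<pi> e \<noteq> e \<longrightarrow> e \<in> maker_edges (?h m) \<longrightarrow>
             \<pi> e \<in> set (?h m) - maker_edges (?h m))" for m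
      proof (induction m)
        case 0
        show ?case
          by (simp add: maker_edges_def)
      next
        case (Suc m)
        define h where "h = ?h m"
        define a where "a = \<tau> h"
        define b where "b = \<sigma> (h @ [a])"
        have step: "?h (Suc m) = h @ [a, b]"
          by (simp add: h_def a_def b_def)
        have IH: "length h = 2 * m" "set h \<subseteq> E" "card (F - set h) \<le> card F - m"
          "\<And>e. \<lbrakk>e \<in> F; \<pi> e \<in> F; \<pi> e \<noteq> e; e \<in> maker_edges h\<rbrakk> \<Longrightarrow> \<pi> e \<in> set h \<and> \<pi> e \<notin> maker_edges h"
          using Suc unfolding h_def by auto
        have a: "a \<in> E - set h" and b: "b \<in> E - set (h @ [a])"
          unfolding a_def b_def by (rule legal_\<tau> legal)+
        have maker: "maker_edges (h @ [a, b]) = insert a (maker_edges h)"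
          using IH(1) by (simp add: maker_edges_round)
        have "card (F - set (h @ [a, b])) \<le> card F - Suc m"
        proof (cases "F - set (h @ [a]) = {}")
          case True
          then have no_edge: "F - set (h @ [a, b]) = {}" by auto
          show ?thesis unfolding no_edge by simp
        next
          case False
          then have "b \<in> F - set (h @ [a])"
            unfolding b_def by (rule reply_in_F)
          then have "F - set (h @ [a, b]) \<subset> F - set h"
            by auto
          then have "card (F - set (h @ [a, b])) < card (F - set h)"
            using \<open>finite F\<close> by (intro psubset_card_mono) auto
          then show ?thesis using IH(3) by simp
        qed
        moreover have "\<pi> e \<in> set (h @ [a, b]) - maker_edges (h @ [a, b])"
          if e: "e \<in> F" "\<pi> e \<in> F" "\<pi> e \<noteq> e" "e \<in> maker_edges (h @ [a, b])" for e
        proof (cases "e \<in> maker_edges h")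
          case True
          then show ?thesis
            using IH(4)[of e] e a by (auto simp: maker)
        next
          case False
          then have [simp]: "e = a"
            using e by (simp add: maker)
          show ?thesis
          proof (cases "\<pi> a \<in> set h")
            case True
            \<comment> \<open>Had Maker owned the partner of \<open>a\<close>, then \<open>a\<close> would have been claimed before.\<close>
            have "\<pi> a \<notin> maker_edges h"
              using IH(4)[of "\<pi> a"] involution e a by auto
            then show ?thesis
              unfolding maker using True e(3) by simp
          next
            case False
            have "\<pi> a \<noteq> a"
              using e(3) by simp
            with False have "b = \<pi> a"
              using e(2) by (simp add: b_def \<sigma>_def)
            moreover have "\<pi> a \<notin> insert a (maker_edges h)"
              using False \<open>\<pi> a \<noteq> a\<close> maker_edges_subset[of h] by blast
            ultimately show ?thesis
              unfolding maker by simp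
          qed
        qed
        ultimately show ?case
          unfolding step using IH(1,2) a b by simp
      qed
      have "card (F - set (?h (card F))) = 0"
        using invariant[of "card F"] by (simp only: diff_self_eq_0 le_zero_eq)
      then have "F \<subseteq> set (?h (card F))"
        using \<open>finite F\<close> by auto
      then show "\<exists>k. set (play \<tau> \<sigma> k) \<subseteq> E \<and> F \<subseteq> set (play \<tau> \<sigma> k) \<and>
             (\<forall>e\<in>F. \<pi> e \<in> F \<longrightarrow> \<pi> e \<noteq> e \<longrightarrow> e \<in> maker_edges (play \<tau> \<sigma> k) \<longrightarrow>
                \<pi> e \<notin> maker_edges (play \<tau> \<sigma> k))"
        using invariant[of "card F"] by (intro exI[of _ "2 * card F"]) blast
    qed
  qed
qed

section \<open>The east-north pairing on a board with finite oriented clusters\<close>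

definition east :: "vertex \<Rightarrow> edge" where
  "east v = {v, v + (1, 0)}"

definition north :: "vertex \<Rightarrow> edge" where
  "north v = {v, v + (0, 1)}"

lemma inj_east: "inj east"
proof (rule injI)
  fix v w assume "east v = east w"
  then have "v = w \<or> v = w + (1, 0) \<and> v + (1, 0) = w"
    unfolding east_def doubleton_eq_iff by blast
  then show "v = w"
    by (elim disjE) (simp, simp add: prod_eq_iff, presburger)
qed

lemma inj_north: "inj north"
proof (rule injI)
  fix v w assume "north v = north w"
  then have "v = w \<or> v = w + (0, 1) \<and> v + (0, 1) = w"
    unfolding north_def doubleton_eq_iff by blast
  then show "v = w"
    by (elim disjE) (simp, simp add: prod_eq_iff, presburger)
qed

lemma east_neq_north: "east v \<noteq> north w"
  by (simp add: east_def north_def doubleton_eq_iff prod_eq_iff)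

definition corner_partner :: "edge \<Rightarrow> edge" where
  "corner_partner e =
     (if e \<in> range east then north (inv east e)
      else if e \<in> range north then east (inv north e)
      else e)"

lemma corner_partner_east: "corner_partner (east v) = north v"
  by (simp add: corner_partner_def inj_east)

lemma corner_partner_north: "corner_partner (north v) = east v"
proof -
  have "north v \<notin> range east"
    using east_neq_north by (metis rangeE)
  then show ?thesis
    by (simp add: corner_partner_def inj_north)
qed

lemma corner_partner_involution: "corner_partner (corner_partner e) = e"
proof -
  consider v where "e = east v" | v where "e = north v" | "e \<notin> range east" "e \<notin> range north"
    by blast
  then show ?thesis
  proof cases
    case 1
    then show ?thesis by (simp only: corner_partner_east corner_partner_north)
  next
    case 2
    then show ?thesis by (simp only: corner_partner_east corner_partner_north)
  next
    case 3
    then show ?thesis by (simp only: corner_partner_def if_False)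
  qed
qed

definition oriented_part :: "edge set \<Rightarrow> (vertex \<times> vertex) set" where
  "oriented_part E = {(v, w) \<in> NE_edges. {v, w} \<in> E}"

lemma oriented_part_cases:
  assumes "(v, w) \<in> oriented_part E"
  obtains "w = v + (1, 0)" "east v \<in> E" | "w = v + (0, 1)" "north v \<in> E"
proof -
  have "w = v + (1, 0) \<or> w = v + (0, 1)" and edge: "{v, w} \<in> E"
    using assms by (simp_all add: oriented_part_def NE_edges_iff)
  then show thesis
    using that unfolding east_def north_def by (metis (no_types))
qed

lemma oriented_part_mono: "G \<subseteq> E \<Longrightarrow> oriented_part G \<subseteq> oriented_part E"
  by (auto simp: oriented_part_def)

text \<open>North-east steps increase the sum of the coordinates, so a highest vertex of a finite cluster is
  terminal.\<close>

lemma exists_terminal_vertex: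
  assumes "F \<subseteq> NE_edges" and "finite (F\<^sup>* `` {v})"
  obtains t where "(v, t) \<in> F\<^sup>*" "\<And>w. (t, w) \<notin> F"
proof -
  let ?S = "F\<^sup>* `` {v}"
  let ?height = "\<lambda>w :: vertex. fst w + snd w"
  have "?S \<noteq> {}"
    by blast
  with assms(2) obtain t where t: "t \<in> ?S" "Max (?height ` ?S) = ?height t"
    by (rule obtains_MAX)
  have highest: "?height w \<le> ?height t" if "w \<in> ?S" for w
    using Max_ge[of "?height ` ?S" "?height w"] assms(2) that unfolding t(2) by blast
  have "(t, w) \<notin> F" for w
  proof
    assume edge: "(t, w) \<in> F"
    then have "w \<in> ?S"
      using t(1) by (blast intro: rtrancl_into_rtrancl)
    then have "?height w \<le> ?height t"
      by (rule highest)
    moreover have "w = t + (1, 0) \<or> w = t + (0, 1)"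
      using edge assms(1) NE_edges_iff by blast
    ultimately show False
      by (elim disjE) simp_all
  qed
  then show thesis
    using t(1) that by blast
qed

text \<open>
  The vertices with a forward path to \<open>t\<close> form a set that no edge of \<open>G\<close> leaves, as explained at the
  beginning. Out-degree at most one is demanded only on the union of the backward clusters of
  all possible endpoints \<open>t\<close>, because this union can be read off from the board \<open>E\<close> alone, whereas
  \<open>t\<close> depends on the course of the game.
\<close>

lemma component_subset_backward_cluster:
  assumes E: "E \<subseteq> Z2_edges" and "G \<subseteq> E"
    and finite_forward: "finite ((oriented_part E)\<^sup>* `` {v\<^sub>0})"
    and corner: "\<And>v. v \<in> ((oriented_part E)\<inverse>)\<^sup>* `` ((oriented_part E)\<^sup>* `` {v\<^sub>0}) \<Longrightarrow>
                   \<not> (east v \<in> G \<and> north v \<in> G)"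
  shows "component G v\<^sub>0 \<subseteq> ((oriented_part E)\<inverse>)\<^sup>* `` ((oriented_part E)\<^sup>* `` {v\<^sub>0})" (is "_ \<subseteq> ?R")
proof -
  let ?D = "oriented_part G"
  have mono: "?D\<^sup>* \<subseteq> (oriented_part E)\<^sup>*"
    using \<open>G \<subseteq> E\<close> by (intro rtrancl_mono oriented_part_mono)
  have "finite (?D\<^sup>* `` {v\<^sub>0})"
    by (rule finite_subset[OF _ finite_forward]) (use mono in blast)
  then obtain t where t: "(v\<^sub>0, t) \<in> ?D\<^sup>*" and terminal: "\<And>w. (t, w) \<notin> ?D"
    using exists_terminal_vertex[of ?D v\<^sub>0] by (auto simp: oriented_part_def)
  define B where "B = {w. (w, t) \<in> ?D\<^sup>*}"
  have B_R: "B \<subseteq> ?R"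
    using t mono by (auto simp: B_def rtrancl_converse)
  have closed: "w' \<in> B" if "w \<in> B" and edge: "{w, w'} \<in> G" for w w'
  proof -
    have "{w, w'} \<in> Z2_edges"
      using edge \<open>G \<subseteq> E\<close> E by blast
    then show ?thesis
    proof (cases rule: Z2_edges_cases)
      case 1
      then have w': "(w, w') \<in> ?D"
        using edge by (simp add: oriented_part_def)
      have "(w, t) \<in> ?D\<^sup>*"
        using \<open>w \<in> B\<close> by (simp add: B_def)
      then obtain u where u: "(w, u) \<in> ?D" "(u, t) \<in> ?D\<^sup>*"
        using w' terminal by (metis converse_rtranclE)
      have "\<not> (east w \<in> G \<and> north w \<in> G)"
        using corner B_R \<open>w \<in> B\<close> by blast
      then have "u = w'"
        using u(1) w' by (auto elim!: oriented_part_cases)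
      then show ?thesis
        using u by (simp add: B_def)
    next
      case 2
      then have "(w', w) \<in> ?D"
        using edge by (simp add: oriented_part_def insert_commute)
      then show ?thesis
        using \<open>w \<in> B\<close> by (auto simp: B_def intro: converse_rtrancl_into_rtrancl)
    qed
  qed
  have "w \<in> B" if "(v\<^sub>0, w) \<in> {(a, b). {a, b} \<in> G}\<^sup>*" for w
    using that
  proof induction
    case base
    show ?case using t by (simp add: B_def)
  next
    case (step y z)
    then show ?case using closed by blast
  qed
  then show ?thesis
    using B_R by (auto simp: component_def)
qed

lemma finite_component:
  assumes "finite E" "E \<subseteq> Z2_edges"
  shows "finite (component E v)"
proof -
  have "w \<in> insert v (\<Union>E)" if "(v, w) \<in> {(a, b). {a, b} \<in> E}\<^sup>*" for w
    using that
  proof induction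
    case (step x y)
    then have "{x, y} \<in> E" by simp
    then show ?case by blast
  qed simp
  then have "component E v \<subseteq> insert v (\<Union>E)"
    by (auto simp: component_def)
  moreover have "finite e" if "e \<in> E" for e
  proof -
    from that assms(2) obtain x y where "e = {x, y}"
      unfolding Z2_edges_def by blast
    then show ?thesis by simp
  qed
  then have "finite (insert v (\<Union>E))"
    using assms(1) by simp
  ultimately show ?thesis
    by (rule finite_subset)
qed

text \<open>
  Finite boards are treated apart: once all edges are claimed, legality no longer restricts the
  moves, so the analysis of the pairing strategy needs an infinite board. On a finite board Breaker
  has won before the first move.
\<close>

lemma breaker_wins_on_finite_board:
  assumes "finite E" "E \<subseteq> Z2_edges"
  shows "breaker_wins_game E"
proof -
  have "legal_strategy E (\<lambda>h. SOME e. e \<in> unclaimed_edges E h)"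
    by (simp add: legal_strategy_def some_in_eq)
  moreover have "breaker_won E v (play \<tau> \<sigma> 0)" for v \<tau> \<sigma>
    using finite_component[OF assms] by (simp add: breaker_won_def maker_edges_def unclaimed_edges_def)
  ultimately show ?thesis
    unfolding breaker_wins_game_def breaker_winning_strategy_def by blast
qed

lemma breaker_wins_if_oriented_clusters_finite:
  assumes E: "E \<subseteq> Z2_edges"
    and forward: "\<And>v. finite ((oriented_part E)\<^sup>* `` {v})"
    and backward: "\<And>v. finite (((oriented_part E)\<inverse>)\<^sup>* `` {v})"
  shows "breaker_wins_game E"
proof (cases "finite E")
  case True
  then show ?thesis
    using E by (rule breaker_wins_on_finite_board)
next
  case False
  show ?thesis
    unfolding breaker_wins_game_def
  proof
    fix v\<^sub>0
    define R where "R = ((oriented_part E)\<inverse>)\<^sup>* `` ((oriented_part E)\<^sup>* `` {v\<^sub>0})"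
    define F where "F = E \<inter> (east ` R \<union> north ` R)"
    have "R = (\<Union>t\<in>(oriented_part E)\<^sup>* `` {v\<^sub>0}. ((oriented_part E)\<inverse>)\<^sup>* `` {t})"
      unfolding R_def by blast
    also have "finite \<dots>"
      by (intro finite_UN_I forward backward)
    finally have "finite R" .
    then have "finite F"
      by (simp add: F_def)
    have "F \<subseteq> E"
      by (simp add: F_def)
    obtain \<sigma> where legal: "legal_strategy E \<sigma>"
      and \<sigma>: "\<forall>\<tau>. legal_strategy E \<tau> \<longrightarrow> (\<exists>k. set (play \<tau> \<sigma> k) \<subseteq> E \<and> F \<subseteq> set (play \<tau> \<sigma> k) \<and>
           (\<forall>e\<in>F. corner_partner e \<in> F \<longrightarrow> corner_partner e \<noteq> e \<longrightarrow> e \<in> maker_edges (play \<tau> \<sigma> k) \<longrightarrow>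
              corner_partner e \<notin> maker_edges (play \<tau> \<sigma> k)))"
      by (rule pairing_strategy[OF False \<open>finite F\<close> \<open>F \<subseteq> E\<close> corner_partner_involution])
    have "\<exists>k. breaker_won E v\<^sub>0 (play \<tau> \<sigma> k)" if \<tau>: "legal_strategy E \<tau>" for \<tau>
    proof -
      obtain k where k: "set (play \<tau> \<sigma> k) \<subseteq> E" "F \<subseteq> set (play \<tau> \<sigma> k)"
        "\<forall>e\<in>F. corner_partner e \<in> F \<longrightarrow> corner_partner e \<noteq> e \<longrightarrow> e \<in> maker_edges (play \<tau> \<sigma> k) \<longrightarrow>
          corner_partner e \<notin> maker_edges (play \<tau> \<sigma> k)"
        using \<sigma>[THEN spec, THEN mp, OF \<tau>] by (elim exE conjE)
      define M where "M = maker_edges (play \<tau> \<sigma> k)"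
      define G where "G = M \<union> unclaimed_edges E (play \<tau> \<sigma> k)"
      have "G \<subseteq> E"
        using k(1) maker_edges_subset unfolding G_def M_def unclaimed_edges_def by blast
      have "\<not> (east v \<in> G \<and> north v \<in> G)" if "v \<in> R" for v
      proof
        assume *: "east v \<in> G \<and> north v \<in> G"
        then have "east v \<in> F" "north v \<in> F"
          using \<open>G \<subseteq> E\<close> that unfolding F_def by blast+
        moreover from this have "east v \<in> M" "north v \<in> M"
          using * k(2) unfolding G_def unclaimed_edges_def by blast+
        ultimately show False
          using k(3)[THEN bspec, of "east v"] east_neq_north[of v v]
          by (simp add: corner_partner_east M_def)
      qed
      then have "component G v\<^sub>0 \<subseteq> R"
        unfolding R_def by (rule component_subset_backward_cluster[OF E \<open>G \<subseteq> E\<close> forward])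
      then have "finite (component G v\<^sub>0)"
        using \<open>finite R\<close> by (rule finite_subset)
      then show ?thesis
        unfolding breaker_won_def G_def M_def by (rule exI)
    qed
    then show "\<exists>\<sigma>. breaker_winning_strategy E v\<^sub>0 \<sigma>"
      using legal unfolding breaker_winning_strategy_def by blast
  qed
qed

section \<open>Subcritical oriented clusters are finite\<close>

lemma prob_space_bond_percolation: "prob_space (bond_percolation A p)"
  unfolding bond_percolation_def by (intro prob_space_PiM measure_pmf.prob_space_axioms)

lemma measurable_edge_open:
  assumes "e \<in> A"
  shows "Measurable.pred (bond_percolation A p) (\<lambda>\<omega>. \<omega> e)"
proof -
  have "(\<lambda>\<omega>. \<omega> e) \<in> bond_percolation A p \<rightarrow>\<^sub>M measure_pmf (bernoulli_pmf p)"
    unfolding bond_percolation_def by (rule measurable_component_singleton[OF assms])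
  then show ?thesis
    by (simp cong: measurable_cong_sets)
qed

lemma measurable_oriented_path_of_length:
  "Measurable.pred (bond_percolation NE_edges p)
     (\<lambda>\<omega>. oriented_path_of_length (open_edges NE_edges \<omega>) n v)"
proof (induction n arbitrary: v)
  case (Suc n)
  have edges: "(v, v + (1, 0)) \<in> NE_edges" "(v, v + (0, 1)) \<in> NE_edges"
    by (simp_all add: NE_edges_iff)
  note [measurable] = Suc measurable_edge_open[OF edges(1)] measurable_edge_open[OF edges(2)]
  have "oriented_path_of_length (open_edges NE_edges \<omega>) (Suc n) v \<longleftrightarrow>
      \<omega> (v, v + (1, 0)) \<and> oriented_path_of_length (open_edges NE_edges \<omega>) n (v + (1, 0)) \<or>
      \<omega> (v, v + (0, 1)) \<and> oriented_path_of_length (open_edges NE_edges \<omega>) n (v + (0, 1))" for \<omega>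
    unfolding oriented_path_of_length.simps(2) open_edges_def mem_Collect_eq NE_edges_iff by blast
  then show ?case
    by (simp del: oriented_path_of_length.simps)
qed simp

lemma measurable_on_infinite_oriented_path:
  "Measurable.pred (bond_percolation NE_edges p)
     (\<lambda>\<omega>. on_infinite_oriented_path (open_edges NE_edges \<omega>) v)"
proof -
  note [measurable] = measurable_oriented_path_of_length
  have "open_edges NE_edges \<omega> \<subseteq> NE_edges" for \<omega>
    by (auto simp: open_edges_def)
  then show ?thesis
    by (simp add: on_infinite_oriented_path_iff_long_paths)
qed

text \<open>
  A parameter strictly below the infimum cannot belong to the set that defines the threshold.
  Measurability is needed in addition, since a nonmeasurable set has measure \<open>0\<close> by convention.
\<close>

lemma AE_no_infinite_oriented_path:
  assumes p: "p \<in> {0..1}" "p < oriented_critical_threshold"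
  shows "AE \<omega> in bond_percolation NE_edges p. \<not> on_infinite_oriented_path (open_edges NE_edges \<omega>) (0, 0)"
proof -
  interpret prob_space "bond_percolation NE_edges p"
    by (rule prob_space_bond_percolation)
  let ?A = "{\<omega> \<in> space (bond_percolation NE_edges p).
              on_infinite_oriented_path (open_edges NE_edges \<omega>) (0, 0)}"
  have "\<not> prob ?A > 0"
  proof
    assume "prob ?A > 0"
    then have "oriented_critical_threshold \<le> p"
      unfolding oriented_critical_threshold_def
      using p(1) by (intro cInf_lower bdd_belowI[of _ 0]) auto
    then show False
      using p(2) by simp
  qed
  then have "prob ?A = 0"
    using measure_nonneg[of "bond_percolation NE_edges p" ?A] by linarith
  moreover have "?A \<in> sets (bond_percolation NE_edges p)"
    using measurable_on_infinite_oriented_path[where p = p and v = "(0, 0)"] by (simp add: pred_def)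
  ultimately have "?A \<in> null_sets (bond_percolation NE_edges p)"
    by (simp add: null_sets_def emeasure_eq_measure)
  then show ?thesis
    by (rule AE_I') simp
qed

text \<open>
  With sign \<open>1\<close> this is translation by \<open>v\<close>; with sign \<open>-1\<close> it is the point reflection that turns
  north-east paths from the origin into south-west paths from \<open>v\<close>.
\<close>

definition affine_image :: "int \<Rightarrow> vertex \<Rightarrow> vertex \<Rightarrow> vertex" where
  "affine_image s v a = (fst v + s * fst a, snd v + s * snd a)"

lemma affine_image_origin: "affine_image s v (0, 0) = v"
  by (simp add: affine_image_def)

definition reindex_edge :: "int \<Rightarrow> vertex \<Rightarrow> vertex \<times> vertex \<Rightarrow> edge" where
  "reindex_edge s v = (\<lambda>(a, b). {affine_image s v a, affine_image s v b})"

lemma reindex_edge_in_Z2_edges: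
  assumes "s \<in> {1, -1}"
  shows "reindex_edge s v \<in> NE_edges \<rightarrow> Z2_edges"
proof
  fix e assume "e \<in> NE_edges"
  moreover obtain a b where "e = (a, b)" by (cases e)
  ultimately show "reindex_edge s v e \<in> Z2_edges"
    using assms unfolding reindex_edge_def Z2_edges_def mem_Collect_eq
    by (intro exI[of _ "affine_image s v a"] exI[of _ "affine_image s v b"])
       (auto simp: NE_edges_iff affine_image_def)
qed

lemma inj_affine_image:
  assumes "s \<in> {1, -1}"
  shows "inj (affine_image s v)"
proof (rule injI)
  fix a b assume "affine_image s v a = affine_image s v b"
  then have "s * fst a = s * fst b" "s * snd a = s * snd b"
    by (simp_all add: affine_image_def)
  then show "a = b"
    using assms by (auto intro: prod_eqI)
qed

lemma NE_edges_asym: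
  assumes "(a, b) \<in> NE_edges" "(b, a) \<in> NE_edges"
  shows False
proof -
  have increasing: "fst a + snd a < fst b + snd b" if "(a, b) \<in> NE_edges" for a b
    using that unfolding NE_edges_iff by (elim disjE) simp_all
  show False
    using increasing[OF assms(1)] increasing[OF assms(2)] by simp
qed

lemma inj_on_reindex_edge:
  assumes "s \<in> {1, -1}"
  shows "inj_on (reindex_edge s v) NE_edges"
proof (rule inj_onI)
  fix e f assume ef: "e \<in> NE_edges" "f \<in> NE_edges" "reindex_edge s v e = reindex_edge s v f"
  obtain a b c d where [simp]: "e = (a, b)" "f = (c, d)" by (cases e; cases f)
  have "{affine_image s v a, affine_image s v b} = {affine_image s v c, affine_image s v d}"
    using ef(3) by (simp add: reindex_edge_def)
  then have "a = c \<and> b = d \<or> a = d \<and> b = c"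
    unfolding doubleton_eq_iff inj_eq[OF inj_affine_image[OF assms]] .
  then show "e = f"
    using ef(1,2) NE_edges_asym[of c d] by auto
qed

lemma AE_bond_percolation_reindex:
  assumes f: "inj_on f A" "f \<in> A \<rightarrow> B"
    and P: "Measurable.pred (bond_percolation A p) P" and "AE \<omega> in bond_percolation A p. P \<omega>"
  shows "AE \<omega> in bond_percolation B p. P (\<lambda>e\<in>A. \<omega> (f e))"
proof -
  let ?\<phi> = "\<lambda>\<omega>. \<lambda>e\<in>A. \<omega> (f e)"
  have distr: "distr (bond_percolation B p) (bond_percolation A p) ?\<phi> = bond_percolation A p"
    unfolding bond_percolation_def
    by (rule distr_PiM_reindex[OF _ f]) (rule measure_pmf.prob_space_axioms)
  have "?\<phi> \<in> bond_percolation B p \<rightarrow>\<^sub>M bond_percolation A p"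
    unfolding bond_percolation_def
    using f(2) by (intro measurable_restrict measurable_component_singleton) auto
  moreover have "{\<omega> \<in> space (bond_percolation A p). P \<omega>} \<in> sets (bond_percolation A p)"
    using P by (simp add: pred_def)
  ultimately show ?thesis
    using assms(4) by (subst (asm) distr[symmetric]) (simp only: AE_distr_iff)
qed

text \<open>The clusters of \<open>v\<close> on the board are compared with clusters of the origin on the transported
  board by lifting paths edge by edge.\<close>

lemma rtrancl_affine_image:
  assumes step: "\<And>a w. (affine_image s v a, w) \<in> Q \<Longrightarrow> \<exists>b. w = affine_image s v b \<and> (a, b) \<in> F"
  shows "Q\<^sup>* `` {v} \<subseteq> affine_image s v ` (F\<^sup>* `` {(0, 0)})"
proof
  fix w assume "w \<in> Q\<^sup>* `` {v}"
  then have "(v, w) \<in> Q\<^sup>*" by simp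
  then show "w \<in> affine_image s v ` (F\<^sup>* `` {(0, 0)})"
  proof induction
    case base
    show ?case
      using affine_image_origin[of s v] by (intro image_eqI[of _ _ "(0, 0)"]) auto
  next
    case (step y z)
    then obtain a where a: "y = affine_image s v a" "((0, 0), a) \<in> F\<^sup>*" by auto
    moreover obtain b where "z = affine_image s v b" "(a, b) \<in> F"
      using assms[of a z] step.hyps(2) a(1) by blast
    ultimately show ?case by (auto intro: rtrancl_into_rtrancl)
  qed
qed

lemma AE_finite_clusters:
  assumes p: "p \<in> {0..1}" "p < oriented_critical_threshold"
  shows "AE \<omega> in bond_percolation Z2_edges p.
           finite ((oriented_part (open_edges Z2_edges \<omega>))\<^sup>* `` {v}) \<and>
           finite (((oriented_part (open_edges Z2_edges \<omega>))\<inverse>)\<^sup>* `` {v})"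
proof -
  define F where "F s \<omega> = open_edges NE_edges (\<lambda>e\<in>NE_edges. \<omega> (reindex_edge s v e))"
    for s and \<omega> :: "edge \<Rightarrow> bool"
  have "AE \<omega> in bond_percolation Z2_edges p. \<not> on_infinite_oriented_path (F s \<omega>) (0, 0)"
    if s: "s \<in> {1, -1}" for s
    unfolding F_def
    by (rule AE_bond_percolation_reindex[OF inj_on_reindex_edge[OF s] reindex_edge_in_Z2_edges[OF s] _
          AE_no_infinite_oriented_path[OF p]])
       (intro pred_intros_logic measurable_on_infinite_oriented_path)
  then have "AE \<omega> in bond_percolation Z2_edges p.
      \<not> on_infinite_oriented_path (F 1 \<omega>) (0, 0) \<and> \<not> on_infinite_oriented_path (F (- 1) \<omega>) (0, 0)"
    by simp
  then show ?thesis
  proof eventually_elim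
    case (elim \<omega>)
    let ?D = "oriented_part (open_edges Z2_edges \<omega>)"
    have F_iff: "(a, b) \<in> F s \<omega> \<longleftrightarrow> (a, b) \<in> NE_edges \<and> \<omega> {affine_image s v a, affine_image s v b}"
      for s a b
      by (auto simp: F_def open_edges_def reindex_edge_def)
    have D_iff: "(a, b) \<in> ?D \<longleftrightarrow> (a, b) \<in> NE_edges \<and> \<omega> {a, b}" for a b
      by (auto simp: oriented_part_def open_edges_def NE_edge_in_Z2_edges)
    have finite: "finite ((F s \<omega>)\<^sup>* `` {(0, 0)})" if "s \<in> {1, -1}" for s
    proof (rule finite_oriented_cluster)
      show "F s \<omega> \<subseteq> NE_edges"
        unfolding F_def open_edges_def by blast
      show "\<not> on_infinite_oriented_path (F s \<omega>) (0, 0)"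
        using that elim by blast
    qed
    have "?D\<^sup>* `` {v} \<subseteq> affine_image 1 v ` ((F 1 \<omega>)\<^sup>* `` {(0, 0)})"
    proof (rule rtrancl_affine_image)
      fix a w assume *: "(affine_image 1 v a, w) \<in> ?D"
      have "w = affine_image 1 v (w - v)" by (simp add: affine_image_def)
      with * show "\<exists>b. w = affine_image 1 v b \<and> (a, b) \<in> F 1 \<omega>"
        by (intro exI[of _ "w - v"]) (auto simp: D_iff F_iff NE_edges_iff affine_image_def prod_eq_iff)
    qed
    moreover have "(?D\<inverse>)\<^sup>* `` {v} \<subseteq> affine_image (- 1) v ` ((F (- 1) \<omega>)\<^sup>* `` {(0, 0)})"
    proof (rule rtrancl_affine_image)
      fix a w assume *: "(affine_image (- 1) v a, w) \<in> ?D\<inverse>"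
      have "w = affine_image (- 1) v (v - w)" by (simp add: affine_image_def)
      with * show "\<exists>b. w = affine_image (- 1) v b \<and> (a, b) \<in> F (- 1) \<omega>"
        by (intro exI[of _ "v - w"])
           (auto simp: D_iff F_iff NE_edges_iff affine_image_def prod_eq_iff insert_commute)
    qed
    ultimately show ?case
      using finite_subset[OF _ finite_imageI[OF finite[of 1]]]
        finite_subset[OF _ finite_imageI[OF finite[of "- 1"]]] by blast
  qed
qed

theorem theorem1p5:
  fixes p :: real
  assumes "p \<in> {0..1}"
    and "p < oriented_critical_threshold"
  shows "AE \<omega> in bond_percolation Z2_edges p. breaker_wins_game (open_edges Z2_edges \<omega>)"
proof -
  have "AE \<omega> in bond_percolation Z2_edges p. \<forall>v.
           finite ((oriented_part (open_edges Z2_edges \<omega>))\<^sup>* `` {v}) \<and>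
           finite (((oriented_part (open_edges Z2_edges \<omega>))\<inverse>)\<^sup>* `` {v})"
    unfolding AE_all_countable by (intro allI AE_finite_clusters assms)
  then show ?thesis
  proof eventually_elim
    case (elim \<omega>)
    have "open_edges Z2_edges \<omega> \<subseteq> Z2_edges"
      by (auto simp: open_edges_def)
    then show ?case
      using elim by (intro breaker_wins_if_oriented_clusters_finite) auto
  qed
qed

end
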